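(* Let $\Gamma$ be a tropical curve of genus $g\ge 3$ containing a forbidden pattern which is a sprawling node. Then $\Gamma$ does not admit a degree $3$ well-contracted cover, up to tropical modifications; that is, no tropical modification of $\Gamma$ (including $\Gamma$ itself) admits a well-contracted cover of degree $3$.
   Context: **Pattern.** A tropical curve is a connected metric graph $\Gamma$ (with a genus function on points); the pattern refers to its canonical model (obtained by shrinking unbounded ends and, iteratively, leaf edges). $\Gamma$ has a sprawling node if it consists of a 3-valent vertex $x$, three edges $e_1,e_2,e_3$ meeting at $x$, and three pairwise disjoint connected subgraphs $\Gamma_1,\Gamma_2,\Gamma_3$ of positive genus (each contains a cycle), not containing $x$, such that $e_i$ joins $x$ to a vertex of $\Gamma_i$, and there are no further edges. **Modifications.** A tropical modification of $\Gamma$ is a metric graph with the same canonical model obtained by gluing trees (possibly with unbounded edges) to $\Gamma$ at some points. **Covers.** A model of a metric graph is a pair $(G,l)$, a graph with edge lengths; models may be refined by adding 2-valent vertices. A continuous map $\varphi:\Gamma_1\to\Gamma_2$ of metric graphs is a morphism if for suitable models $(G_1,l_1),(G_2,l_2)$ one has $\varphi(V(G_1))\subset V(G_2)$, $\varphi^{-1}(E(G_2))\subset E(G_1)$, and for each $e\in E(G_1)$ the number $\mu_\varphi(e)$, defined as $l_2(\varphi(e))/l_1(e)$ if $\varphi(e)$ is an edge and as $0$ if $\varphi(e)$ is a vertex ($e$ is contracted), is a nonnegative integer, positive in the first case (for unbounded edges $\mu_\varphi(e)$ is the slope). It is non-degenerate if every vertex $v$ has an incident edge $e$ with $\mu_\varphi(e)>0$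 and no loop is contracted. It is harmonic if for each vertex $v$ the number $m_\varphi(v)=\sum_{e\ni v,\ \varphi(e)=e'}\mu_\varphi(e)$ does not depend on the edge $e'$ at $\varphi(v)$; its degree is $\sum_{\varphi(e)=e'}\mu_\varphi(e)$, independent of the edge $e'$ of the target. A tropical cover of degree $d$ is a harmonic morphism of degree $d$ such that for every vertex $v$ whose image has valence at least $2$, $(2m_\varphi(v)-2)-\sum_{e\ni v}(\mu_\varphi(e)-1)\ge 0$ (sum over all outgoing edges at $v$, contracted ones included). A path is a metric tree homeomorphic to an interval (possibly unbounded). A well-contracted cover is a non-degenerate tropical cover whose target is a path. *)

theory Defs
  imports "HOL-Library.Extended_Real"
begin

section \<open>Metric graphs and their models\<close>

text \<open>
  A model is a finite multigraph with edge lengths, given by its flags (outgoing half-edges): a flag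
  \<open>h\<close> leaves the vertex \<open>base h\<close>, and \<open>opp h\<close> is the other flag of the same edge.  A bounded edge is a
  two-element orbit of \<open>opp\<close> (a loop if both flags have the same base), an unbounded edge is a fixed
  point of \<open>opp\<close>; it has length \<open>\<infinity>\<close> and no second end point.

  A metric graph is represented by any of its models; two models describe the same metric graph
  iff they have a common refinement (\<open>same_metric_graph\<close> below).
\<close>

record ('v, 'h) model =
  verts :: "'v set"
  flags :: "'h set"
  base :: "'h \<Rightarrow> 'v"
  opp :: "'h \<Rightarrow> 'h"
  len :: "'h \<Rightarrow> ereal"

definition is_model :: "('v, 'h) model \<Rightarrow> bool" where
  "is_model G \<longleftrightarrow> finite (verts G) \<and> finite (flags G) \<and>
    (\<forall>h\<in>flags G. base G h \<in> verts G \<and> opp G h \<in> flags G \<and> opp G (opp G h) = h \<and>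
       0 < len G h \<and> len G (opp G h) = len G h \<and> (len G h = \<infinity> \<longleftrightarrow> opp G h = h))"

definition adjacency :: "('v, 'h) model \<Rightarrow> ('v \<times> 'v) set" where
  "adjacency G = {(base G h, base G (opp G h)) |h. h \<in> flags G}"

definition connected_model :: "('v, 'h) model \<Rightarrow> bool" where
  "connected_model G \<longleftrightarrow> verts G \<noteq> {} \<and> (\<forall>u\<in>verts G. \<forall>v\<in>verts G. (u, v) \<in> (adjacency G)\<^sup>*)"

definition metric_graph :: "('v, 'h) model \<Rightarrow> bool" where
  "metric_graph G \<longleftrightarrow> is_model G \<and> connected_model G"

definition flags_at :: "('v, 'h) model \<Rightarrow> 'v \<Rightarrow> 'h set" where
  "flags_at G v = {h \<in> flags G. base G h = v}"

definition valence :: "('v, 'h) model \<Rightarrow> 'v \<Rightarrow> nat" where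
  "valence G v = card (flags_at G v)"

definition bounded_edges :: "('v, 'h) model \<Rightarrow> 'h set set" where
  "bounded_edges G = (\<lambda>h. {h, opp G h}) ` {h \<in> flags G. opp G h \<noteq> h}"

text \<open>The first Betti number, for connected \<open>G\<close>; it is positive iff \<open>G\<close> contains a cycle.\<close>

definition betti :: "('v, 'h) model \<Rightarrow> int" where
  "betti G = int (card (bounded_edges G)) - int (card (verts G)) + 1"

text \<open>
  A tropical curve is a metric graph with a genus function on its points which is nonzero at finitely
  many points only.  The model is chosen such that these points are vertices.
\<close>

definition genus :: "('v, 'h) model \<Rightarrow> ('v \<Rightarrow> nat) \<Rightarrow> int" where
  "genus G w = betti G + (\<Sum>v\<in>verts G. int (w v))"

definition isomorphic :: "('v, 'h) model \<Rightarrow> ('w, 'k) model \<Rightarrow> bool" where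
  "isomorphic G H \<longleftrightarrow> (\<exists>\<alpha> \<beta>. bij_betw \<alpha> (verts G) (verts H) \<and> bij_betw \<beta> (flags G) (flags H) \<and>
    (\<forall>h\<in>flags G. base H (\<beta> h) = \<alpha> (base G h) \<and> opp H (\<beta> h) = \<beta> (opp G h) \<and>
       len H (\<beta> h) = len G h))"

text \<open>
  \<open>subdivides G K\<close>: \<open>K\<close> arises by adding a 2-valent vertex \<open>v\<close> on the edge of \<open>h\<close>, at distance \<open>s\<close> from
  \<open>base h\<close>.  The new flags \<open>a\<close> and \<open>b\<close> at \<open>v\<close> point back to \<open>base h\<close> and forward, respectively.  If the
  edge is unbounded, so is the part starting with \<open>b\<close>; in that case \<open>b\<close> is its own opposite.
\<close>

definition subdivides :: "('v, 'h) model \<Rightarrow> ('v, 'h) model \<Rightarrow> bool" where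
  "subdivides G K \<longleftrightarrow> (\<exists>h v a b s. h \<in> flags G \<and> v \<notin> verts G \<and> a \<notin> flags G \<and> b \<notin> flags G \<and> a \<noteq> b \<and>
     0 < s \<and> ereal s < len G h \<and>
     (let b' = (if opp G h = h then b else opp G h) in
      K = \<lparr>verts = insert v (verts G),
           flags = {a, b} \<union> flags G,
           base = (base G)(a := v, b := v),
           opp = (opp G)(b' := b, b := b', h := a, a := h),
           len = (len G)(b' := len G h - ereal s, b := len G h - ereal s,
                         h := ereal s, a := ereal s)\<rparr>))"

definition refines :: "('w, 'k) model \<Rightarrow> ('v, 'h) model \<Rightarrow> bool" where
  "refines K G \<longleftrightarrow> (\<exists>A. isomorphic G A \<and> subdivides\<^sup>*\<^sup>* A K)"

text \<open>
  Here and below, models bound by an existential quantifier may be taken over \<^typ>\<open>nat\<close>, as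
  models are finite.
\<close>

definition same_metric_graph :: "('v, 'h) model \<Rightarrow> ('w, 'k) model \<Rightarrow> bool" where
  "same_metric_graph G H \<longleftrightarrow> metric_graph G \<and> metric_graph H \<and>
    (\<exists>K :: (nat, nat) model. refines K G \<and> refines K H)"


section \<open>Canonical models, sprawling nodes and modifications\<close>

definition shrinks_end :: "('v, 'h) model \<Rightarrow> ('v, 'h) model \<Rightarrow> bool" where
  "shrinks_end G H \<longleftrightarrow> (\<exists>h\<in>flags G. opp G h = h \<and> H = G\<lparr>flags := flags G - {h}\<rparr>)"

definition shrinks_leaf :: "('v, 'h) model \<Rightarrow> ('v, 'h) model \<Rightarrow> bool" where
  "shrinks_leaf G H \<longleftrightarrow> (\<exists>v\<in>verts G. \<exists>h. flags_at G v = {h} \<and> opp G h \<noteq> h \<and>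
     H = G\<lparr>verts := verts G - {v}, flags := flags G - {h, opp G h}\<rparr>)"

definition shrinks :: "('v, 'h) model \<Rightarrow> ('v, 'h) model \<Rightarrow> bool" where
  "shrinks G H \<longleftrightarrow> shrinks_end G H \<or> shrinks_leaf G H"

definition canonical_model :: "('v, 'h) model \<Rightarrow> ('v, 'h) model \<Rightarrow> bool" where
  "canonical_model G C \<longleftrightarrow> shrinks\<^sup>*\<^sup>* G C \<and> (\<nexists>D. shrinks C D)"

definition subgraph :: "('v, 'h) model \<Rightarrow> ('v, 'h) model \<Rightarrow> bool" where
  "subgraph S G \<longleftrightarrow> is_model S \<and> verts S \<subseteq> verts G \<and> flags S \<subseteq> flags G \<and>
    (\<forall>h\<in>flags S. base S h = base G h \<and> opp S h = opp G h \<and> len S h = len G h)"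

text \<open>The flags \<open>h 0, h 1, h 2\<close> at \<open>x\<close> represent the edges \<open>e\<^sub>1, e\<^sub>2, e\<^sub>3\<close>.\<close>

definition sprawling_at ::
  "('v, 'h) model \<Rightarrow> 'v \<Rightarrow> (nat \<Rightarrow> 'h) \<Rightarrow> (nat \<Rightarrow> ('v, 'h) model) \<Rightarrow> bool" where
  "sprawling_at H x h S \<longleftrightarrow>
     x \<in> verts H \<and> valence H x = 3 \<and> flags_at H x = h ` {..<3} \<and>
     (\<forall>i<3. subgraph (S i) H \<and> connected_model (S i) \<and> betti (S i) > 0 \<and>
        x \<notin> verts (S i) \<and> base H (opp H (h i)) \<in> verts (S i)) \<and>
     (\<forall>i<3. \<forall>j<3. i \<noteq> j \<longrightarrow> verts (S i) \<inter> verts (S j) = {}) \<and>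
     verts H = {x} \<union> (\<Union>i<3. verts (S i)) \<and>
     flags H = (\<Union>i<3. {h i, opp H (h i)} \<union> flags (S i))"

text \<open>
  The pattern is a property of the canonical model as a metric graph; it may be exhibited in any
  of its graph models, in particular in the one without superfluous 2-valent vertices.
\<close>

definition has_sprawling_node :: "('v, 'h) model \<Rightarrow> bool" where
  "has_sprawling_node G \<longleftrightarrow> (\<exists>C (H :: (nat, nat) model) x h S.
     canonical_model G C \<and> same_metric_graph H C \<and> sprawling_at H x h S)"

text \<open>
  Gluing a finite tree amounts to successively attaching leaf edges and unbounded edges, the inverse
  of \<^const>\<open>shrinks\<close>.  The gluing points need not be vertices of \<open>G\<close>, whence the
  change of model from \<open>G\<close> to \<open>G'\<close>.
\<close>

definition tropical_modification :: "('w, 'k) model \<Rightarrow> ('v, 'h) model \<Rightarrow> bool" where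
  "tropical_modification M G \<longleftrightarrow> metric_graph M \<and>
    (\<exists>G'. shrinks\<^sup>*\<^sup>* M G' \<and> same_metric_graph G' G)"

lemma canonical_model_glued:
  assumes "shrinks\<^sup>*\<^sup>* M G'" and "canonical_model G' C"
  shows "canonical_model M C"
  using assms unfolding canonical_model_def by auto

lemma same_metric_graph_refl:
  assumes "metric_graph (G :: ('v, 'h) model)"
  shows "same_metric_graph G G"
proof -
  have fin: "finite (verts G)" "finite (flags G)"
    using assms by (auto simp: metric_graph_def is_model_def)
  obtain \<alpha> :: "'v \<Rightarrow> nat" where \<alpha>: "inj_on \<alpha> (verts G)"
    using finite_imp_inj_to_nat_seg[OF fin(1)] by blast
  obtain \<beta> :: "'h \<Rightarrow> nat" where \<beta>: "inj_on \<beta> (flags G)"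
    using finite_imp_inj_to_nat_seg[OF fin(2)] by blast
  define r where "r = inv_into (flags G) \<beta>"
  define K where "K = \<lparr>verts = \<alpha> ` verts G, flags = \<beta> ` flags G, base = (\<lambda>k. \<alpha> (base G (r k))),
    opp = (\<lambda>k. \<beta> (opp G (r k))), len = (\<lambda>k. len G (r k))\<rparr>"
  have "isomorphic G K"
    unfolding isomorphic_def K_def r_def
    by (intro exI[of _ \<alpha>] exI[of _ \<beta>]) (use \<alpha> \<beta> in \<open>auto simp: bij_betw_def\<close>)
  then have "refines K G"
    unfolding refines_def by blast
  then show ?thesis
    using assms unfolding same_metric_graph_def by blast
qed

lemma tropical_modification_refl:
  assumes "metric_graph G"
  shows "tropical_modification G G"
  unfolding tropical_modification_def using assms same_metric_graph_refl by blast


section \<open>Covers\<close>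

text \<open>
  A morphism is given on models of source and target by its effect on vertices and flags, where
  \<open>on_flags f h = None\<close> means that the edge of \<open>h\<close> is contracted, and by its multiplicities
  \<open>mult f h\<close>.  On a bounded edge these are determined by the lengths; on an unbounded edge, where the
  condition on lengths reads \<open>\<infinity> = \<mu> * \<infinity>\<close>, they are the slope of the map.
\<close>

record ('v, 'h, 'w, 'k) graph_map =
  on_verts :: "'v \<Rightarrow> 'w"
  on_flags :: "'h \<Rightarrow> 'k option"
  mult :: "'h \<Rightarrow> nat"

definition graph_morphism ::
  "('v, 'h) model \<Rightarrow> ('w, 'k) model \<Rightarrow> ('v, 'h, 'w, 'k) graph_map \<Rightarrow> bool" where
  "graph_morphism G P f \<longleftrightarrow> is_model G \<and> is_model P \<and> on_verts f ` verts G \<subseteq> verts P \<and>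
    (\<forall>h\<in>flags G. case on_flags f h of
       None \<Rightarrow> mult f h = 0 \<and> on_flags f (opp G h) = None \<and>
               on_verts f (base G (opp G h)) = on_verts f (base G h)
     | Some h' \<Rightarrow> h' \<in> flags P \<and> base P h' = on_verts f (base G h) \<and>
               on_flags f (opp G h) = Some (opp P h') \<and>
               mult f h > 0 \<and> len P h' = ereal (real (mult f h)) * len G h)"

definition non_degenerate :: "('v, 'h) model \<Rightarrow> ('v, 'h, 'w, 'k) graph_map \<Rightarrow> bool" where
  "non_degenerate G f \<longleftrightarrow>
    (\<forall>v\<in>verts G. \<exists>h\<in>flags_at G v. mult f h > 0) \<and>
    (\<forall>h\<in>flags G. opp G h \<noteq> h \<and> base G (opp G h) = base G h \<longrightarrow> on_flags f h \<noteq> None)"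

text \<open>\<open>m\<^sub>f(v)\<close>, computed with respect to an edge of the target leaving \<open>f(v)\<close> with flag \<open>h'\<close>.\<close>

definition local_degree ::
  "('v, 'h) model \<Rightarrow> ('v, 'h, 'w, 'k) graph_map \<Rightarrow> 'v \<Rightarrow> 'k \<Rightarrow> nat" where
  "local_degree G f v h' = (\<Sum>h\<in>{h \<in> flags_at G v. on_flags f h = Some h'}. mult f h)"

definition harmonic ::
  "('v, 'h) model \<Rightarrow> ('w, 'k) model \<Rightarrow> ('v, 'h, 'w, 'k) graph_map \<Rightarrow> bool" where
  "harmonic G P f \<longleftrightarrow> graph_morphism G P f \<and>
    (\<forall>v\<in>verts G. \<forall>h'\<in>flags_at P (on_verts f v). \<forall>h''\<in>flags_at P (on_verts f v).
       local_degree G f v h' = local_degree G f v h'')"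

definition has_degree ::
  "('v, 'h) model \<Rightarrow> ('w, 'k) model \<Rightarrow> ('v, 'h, 'w, 'k) graph_map \<Rightarrow> nat \<Rightarrow> bool" where
  "has_degree G P f d \<longleftrightarrow>
    (\<forall>h'\<in>flags P. (\<Sum>h\<in>{h \<in> flags G. on_flags f h = Some h'}. mult f h) = d)"

definition tropical_cover ::
  "('v, 'h) model \<Rightarrow> ('w, 'k) model \<Rightarrow> ('v, 'h, 'w, 'k) graph_map \<Rightarrow> nat \<Rightarrow> bool" where
  "tropical_cover G P f d \<longleftrightarrow> harmonic G P f \<and> has_degree G P f d \<and>
    (\<forall>v\<in>verts G. valence P (on_verts f v) \<ge> 2 \<longrightarrow>
      (\<forall>h'\<in>flags_at P (on_verts f v).
        (2 * int (local_degree G f v h') - 2) - (\<Sum>h\<in>flags_at G v. int (mult f h) - 1) \<ge> 0))"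

text \<open>
  A metric tree is homeomorphic to a (nondegenerate, possibly unbounded) interval iff it has an
  edge and no vertex of valence greater than 2.
\<close>

definition is_path :: "('w, 'k) model \<Rightarrow> bool" where
  "is_path P \<longleftrightarrow> metric_graph P \<and> betti P = 0 \<and> flags P \<noteq> {} \<and> (\<forall>v\<in>verts P. valence P v \<le> 2)"

definition well_contracted_cover ::
  "('v, 'h) model \<Rightarrow> ('w, 'k) model \<Rightarrow> ('v, 'h, 'w, 'k) graph_map \<Rightarrow> nat \<Rightarrow> bool" where
  "well_contracted_cover G P f d \<longleftrightarrow> tropical_cover G P f d \<and> non_degenerate G f \<and> is_path P"

definition admits_well_contracted_cover :: "('v, 'h) model \<Rightarrow> nat \<Rightarrow> bool" where
  "admits_well_contracted_cover M d \<longleftrightarrow> (\<exists>(K :: (nat, nat) model) (P :: (nat, nat) model) f.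
     same_metric_graph K M \<and> well_contracted_cover K P f d)"

end

theory Submission imports Defs begin

text \<open>
  A sprawling node is used only through the following feature: removing the point \<open>x\<close> leaves three
  disconnected parts ("sides"), each containing a cycle.  Gluing trees, and changing the model, neither
  creates paths between different sides nor destroys cycles, so every model of every modification
  still has such a point (\<open>three_cyclic_sides\<close>).  It remains to see that a graph with this feature
  has no well-contracted cover \<open>f\<close> of degree \<open>3\<close>.

  For an edge of the target path, count with multiplicity the edges of one side that lie above it;
  this is \<open>side_degree\<close>.  Away from \<open>x\<close> each side is a harmonic graph over the path, so its count can
  change only at the point \<open>f x\<close> (\<open>side_degree_reaches_image\<close>).  A cycle cannot be embedded into a
  path: it folds, or contains a contracted edge with two different ends, and either way its side
  has count at least \<open>2\<close> somewhere (\<open>cyclic_flags_have_double_point\<close>), hence on an edge at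
  \<open>f x\<close>.  There are at most two edges of the path at \<open>f x\<close> and three sides, so over one of these edges
  two sides have count at least \<open>2\<close> each, and the degree is at least \<open>4\<close>
  (\<open>three_cyclic_sides_no_cover\<close>).

  All transport between models is combinatorial and ignores lengths.  Both the sides and the
  cycles are described by flags, since flags change in a simple way under subdivision and shrinking:
  the sides by a colouring that is constant on edges and at all vertices other than \<open>x\<close>, the existence
  of a cycle by a nonempty set of edges in which every vertex has at least two flags.
\<close>

section \<open>Points with three cyclic sides\<close>

text \<open>
  The part of being a model that concerns incidence only.  It is preserved by isomorphism, subdivision
  and shrinking without any computation with lengths.
\<close>

definition flag_graph :: "('v, 'h) model \<Rightarrow> bool" where
  "flag_graph G \<longleftrightarrow>
    (\<forall>h\<in>flags G. base G h \<in> verts G \<and> opp G h \<in> flags G \<and> opp G (opp G h) = h)"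

lemma flag_graphD:
  assumes "flag_graph G" "h \<in> flags G"
  shows "base G h \<in> verts G" "opp G h \<in> flags G" "opp G (opp G h) = h"
  using assms by (auto simp: flag_graph_def)

lemma is_model_imp_flag_graph: "is_model G \<Longrightarrow> flag_graph G"
  by (auto simp: is_model_def flag_graph_def)

lemma metric_graph_imp_flag_graph: "metric_graph G \<Longrightarrow> flag_graph G"
  by (auto simp: metric_graph_def is_model_imp_flag_graph)

text \<open>
  A bounded subgraph of minimal degree at least two, which contains a cycle if it is finite.  Unlike a
  cyclic sequence of edges, such a flag set can be enlarged, restricted and mapped without choosing an order.
\<close>

definition cyclic_flags :: "('v, 'h) model \<Rightarrow> 'h set \<Rightarrow> bool" where
  "cyclic_flags G Z \<longleftrightarrow> Z \<noteq> {} \<and> Z \<subseteq> flags G \<and>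
    (\<forall>h\<in>Z. opp G h \<in> Z \<and> opp G h \<noteq> h \<and> (\<exists>h'\<in>Z. h' \<noteq> h \<and> base G h' = base G h))"

text \<open>
  Such a colouring is constant on the connected components of the complement of \<open>x\<close>; a flag at \<open>x\<close>
  has the colour of the component into which it points.
\<close>

definition side_colouring :: "('v, 'h) model \<Rightarrow> 'v \<Rightarrow> ('h \<Rightarrow> nat) \<Rightarrow> bool" where
  "side_colouring G x c \<longleftrightarrow>
    (\<forall>h\<in>flags G. c (opp G h) = c h) \<and>
    (\<forall>h\<in>flags G. \<forall>h'\<in>flags G. base G h = base G h' \<longrightarrow> base G h \<noteq> x \<longrightarrow> c h = c h')"

lemma side_colouring_opp: "side_colouring G x c \<Longrightarrow> h \<in> flags G \<Longrightarrow> c (opp G h) = c h"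
  by (simp add: side_colouring_def)

lemma side_colouring_base:
  "side_colouring G x c \<Longrightarrow> h \<in> flags G \<Longrightarrow> h' \<in> flags G \<Longrightarrow> base G h = base G h' \<Longrightarrow>
    base G h \<noteq> x \<Longrightarrow> c h = c h'"
  unfolding side_colouring_def by blast

text \<open>
  Flags of all three colours are required at \<open>x\<close>, so that \<open>x\<close> is never one of the 2-valent vertices
  that a subdivision adds.
\<close>

definition three_cyclic_sides :: "('v, 'h) model \<Rightarrow> bool" where
  "three_cyclic_sides G \<longleftrightarrow> (\<exists>x c. side_colouring G x c \<and>
    (\<forall>i<3. (\<exists>h\<in>flags_at G x. c h = i) \<and>
           (\<exists>Z. cyclic_flags G Z \<and> (\<forall>h\<in>Z. base G h \<noteq> x \<and> c h = i))))"

section \<open>Sprawling nodes have three cyclic sides\<close>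

lemma card_involution:
  assumes "finite X" "\<And>h. h \<in> X \<Longrightarrow> r h \<in> X \<and> r h \<noteq> h \<and> r (r h) = h"
  shows "card X = 2 * card ((\<lambda>h. {h, r h}) ` X)"
proof -
  let ?C = "(\<lambda>h. {h, r h}) ` X"
  have un: "\<Union>?C = X" using assms(2) by auto
  have "2 * card ?C = card (\<Union>?C)"
  proof (rule card_partition)
    show "finite ?C" "finite (\<Union>?C)" using assms(1) by auto
    show "card e = 2" if "e \<in> ?C" for e
    proof -
      obtain h where "h \<in> X" "e = {h, r h}" using \<open>e \<in> ?C\<close> by auto
      then show ?thesis using assms(2)[of h] by (auto simp: card_insert_if)
    qed
    show "e \<inter> e' = {}" if "e \<in> ?C" "e' \<in> ?C" "e \<noteq> e'" for e e'
    proof -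
      obtain h h' where "h \<in> X" "e = {h, r h}" "h' \<in> X" "e' = {h', r h'}"
        using \<open>e \<in> ?C\<close> \<open>e' \<in> ?C\<close> by auto
      then show ?thesis
        using \<open>e \<noteq> e'\<close> assms(2)[of h] assms(2)[of h'] by (simp add: doubleton_eq_iff) metis
    qed
  qed
  then show ?thesis using un by simp
qed

lemma card_bounded_flags:
  assumes "is_model G"
  shows "card {h \<in> flags G. opp G h \<noteq> h} = 2 * card (bounded_edges G)"
  unfolding bounded_edges_def
proof (rule card_involution)
  show "finite {h \<in> flags G. opp G h \<noteq> h}" using assms by (simp add: is_model_def)
  fix h assume "h \<in> {h \<in> flags G. opp G h \<noteq> h}"
  then show "opp G h \<in> {h \<in> flags G. opp G h \<noteq> h} \<and> opp G h \<noteq> h \<and> opp G (opp G h) = h"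
    using flag_graphD(2,3)[OF is_model_imp_flag_graph[OF assms]] by force
qed

text \<open>
  The edges are at least as many as the vertices.  A nonempty vertex set of least size with this
  property for its induced subgraph has no vertex of degree at most one, because deleting
  such a vertex costs one vertex and at most one edge.
\<close>

lemma positive_betti_imp_cyclic_flags:
  assumes "is_model G" "verts G \<noteq> {}" "betti G > 0"
  shows "\<exists>Z. cyclic_flags G Z"
proof -
  define Z where "Z W = {h \<in> flags G. opp G h \<noteq> h \<and> base G h \<in> W \<and> base G (opp G h) \<in> W}" for W
  define dense where "dense W \<longleftrightarrow> W \<subseteq> verts G \<and> W \<noteq> {} \<and> 2 * card W \<le> card (Z W)" for W
  have fin: "finite (verts G)" "finite (flags G)" and fg: "flag_graph G"
    using assms(1) by (auto simp: is_model_def is_model_imp_flag_graph)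
  note fgD = flag_graphD[OF fg]
  have finZ: "finite (Z W)" for W using fin by (auto simp: Z_def)
  have "Z (verts G) = {h \<in> flags G. opp G h \<noteq> h}" using fgD by (auto simp: Z_def)
  then have "dense (verts G)"
    using card_bounded_flags[OF assms(1)] assms(2,3) by (auto simp: dense_def betti_def)
  then obtain W where W: "dense W" and min: "\<And>W'. dense W' \<Longrightarrow> card W \<le> card W'"
    using ex_has_least_nat[of dense "verts G" card] by blast
  have finW: "finite W" using W fin by (auto simp: dense_def intro: finite_subset)
  have oppZ: "opp G h \<in> Z W" if "h \<in> Z W" for h using that fgD by (auto simp: Z_def)
  have "\<exists>h'\<in>Z W. h' \<noteq> h \<and> base G h' = base G h" if h: "h \<in> Z W" for h
  proof (rule ccontr)
    assume "\<not> ?thesis"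
    then have only: "\<And>h'. h' \<in> Z W \<Longrightarrow> base G h' = base G h \<Longrightarrow> h' = h" by blast
    let ?v = "base G h"
    have v: "?v \<in> W" using h by (auto simp: Z_def)
    have "Z W - {h, opp G h} \<subseteq> Z (W - {?v})"
    proof
      fix g assume g: "g \<in> Z W - {h, opp G h}"
      then have "base G g \<noteq> ?v" using only by blast
      moreover have "base G (opp G g) \<noteq> ?v"
        using g only[OF oppZ] fgD(3)[of g] by (force simp: Z_def)
      ultimately show "g \<in> Z (W - {?v})" using g by (auto simp: Z_def)
    qed
    then have "card (Z W - {h, opp G h}) \<le> card (Z (W - {?v}))" using finZ by (rule card_mono[rotated])
    moreover have "card (Z W) - card {h, opp G h} \<le> card (Z W - {h, opp G h})"
      by (rule diff_card_le_card_Diff) simp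
    moreover have "card {h, opp G h} \<le> 2" by (simp add: card_insert_if)
    ultimately have "2 * card (W - {?v}) \<le> card (Z (W - {?v}))"
      using W v finW by (auto simp: dense_def)
    \<comment> \<open>If \<open>?v\<close> were the only vertex, the edge of \<open>h\<close> would be a loop and give two flags at \<open>?v\<close>.\<close>
    moreover have "W - {?v} \<noteq> {}"
    proof -
      have "base G (opp G h) \<noteq> ?v" using only[OF oppZ[OF h]] h by (auto simp: Z_def)
      then show ?thesis using h by (auto simp: Z_def)
    qed
    ultimately have "dense (W - {?v})" using W by (auto simp: dense_def)
    from min[OF this] show False using v finW by (metis card_Diff1_less not_le)
  qed
  moreover have "Z W \<noteq> {}" using W finW by (auto simp: dense_def card_eq_0_iff)
  ultimately have "cyclic_flags G (Z W)"
    using oppZ by (auto simp: cyclic_flags_def Z_def)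
  then show ?thesis by blast
qed

text \<open>
  The colour of a flag is the index of the subgraph that contains its base.  A flag at the node itself
  belongs to no subgraph and takes the index of its edge.
\<close>

lemma sprawling_imp_three_cyclic_sides:
  assumes "is_model H" "sprawling_at H x h S"
  shows "three_cyclic_sides H"
proof -
  have fg: "flag_graph H" by (rule is_model_imp_flag_graph) fact
  note fgD = flag_graphD[OF fg]
  have val: "valence H x = 3" and at: "flags_at H x = h ` {..<3}"
    and S: "\<And>i. i < 3 \<Longrightarrow> subgraph (S i) H \<and> connected_model (S i) \<and> betti (S i) > 0 \<and>
        x \<notin> verts (S i) \<and> base H (opp H (h i)) \<in> verts (S i)"
    and disj: "\<And>i j. i < 3 \<Longrightarrow> j < 3 \<Longrightarrow> i \<noteq> j \<Longrightarrow> verts (S i) \<inter> verts (S j) = {}"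
    and fl: "flags H = (\<Union>i<3. {h i, opp H (h i)} \<union> flags (S i))"
    using assms(2) unfolding sprawling_at_def by simp_all
  have inj: "inj_on h {..<3}"
    using val at by (auto simp: valence_def intro!: eq_card_imp_inj_on)
  define c where "c g = (if base H g = x then THE i. i < 3 \<and> g = h i
                         else THE i. i < 3 \<and> base H g \<in> verts (S i))" for g
  have hx: "base H (h i) = x" "h i \<in> flags H" if "i < 3" for i
    using at that by (auto simp: flags_at_def)
  have c_x: "c (h i) = i" if "i < 3" for i
  proof -
    have "(THE j. j < 3 \<and> h i = h j) = i"
      using inj that by (auto simp: inj_on_def)
    then show ?thesis using hx[OF that] by (simp add: c_def)
  qed
  have c_S: "c g = i" if "i < 3" "base H g \<in> verts (S i)" for g i
  proof -
    have "(THE j. j < 3 \<and> base H g \<in> verts (S j)) = i"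
      using that disj by (intro the_equality) auto
    then show ?thesis using S[OF that(1)] that by (auto simp: c_def)
  qed
  have S_fl: "base H g \<in> verts (S i) \<and> opp H g \<in> flags (S i)" if "i < 3" "g \<in> flags (S i)" for g i
    using S[OF that(1)] that(2) by (metis subgraph_def flag_graphD(1,2) is_model_imp_flag_graph)
  have "side_colouring H x c"
    unfolding side_colouring_def
  proof (intro conjI ballI impI)
    fix g assume "g \<in> flags H"
    then obtain i where i: "i < 3" and "g = h i \<or> g = opp H (h i) \<or> g \<in> flags (S i)"
      using fl by auto
    then consider "g = h i" | "g = opp H (h i)" | "g \<in> flags (S i)" by blast
    then show "c (opp H g) = c g"
    proof cases
      case 3
      then show ?thesis using c_S[OF i] S_fl[OF i] by metis
    qed (use c_x[OF i] c_S[OF i] S[OF i] hx[OF i] fgD(3)[of "h i"] in auto)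
  next
    fix g g' assume "base H g = base H g'" "base H g \<noteq> x"
    then show "c g = c g'" by (simp add: c_def)
  qed
  moreover have "(\<exists>g\<in>flags_at H x. c g = i) \<and>
      (\<exists>Z. cyclic_flags H Z \<and> (\<forall>g\<in>Z. base H g \<noteq> x \<and> c g = i))" if i: "i < 3" for i
  proof
    show "\<exists>g\<in>flags_at H x. c g = i" using at c_x[OF i] i by auto
    have sub: "subgraph (S i) H" and "verts (S i) \<noteq> {}" "betti (S i) > 0"
      using S[OF i] by (auto simp: connected_model_def)
    then obtain Z where Z: "cyclic_flags (S i) Z"
      using positive_betti_imp_cyclic_flags[of "S i"] by (auto simp: subgraph_def)
    then have ZS: "Z \<subseteq> flags (S i)" by (simp add: cyclic_flags_def)
    have same: "base (S i) g = base H g" "opp (S i) g = opp H g" if "g \<in> Z" for g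
      using sub ZS that by (auto simp: subgraph_def)
    have "cyclic_flags H Z"
      unfolding cyclic_flags_def
    proof (intro conjI ballI)
      show "Z \<noteq> {}" "Z \<subseteq> flags H" using Z sub by (auto simp: cyclic_flags_def subgraph_def)
      fix g assume g: "g \<in> Z"
      show "opp H g \<in> Z" "opp H g \<noteq> g" "\<exists>h'\<in>Z. h' \<noteq> g \<and> base H h' = base H g"
        using Z g same unfolding cyclic_flags_def by metis+
    qed
    moreover have "base H g \<noteq> x \<and> c g = i" if "g \<in> Z" for g
      using S_fl[OF i] ZS that c_S[OF i] S[OF i] by blast
    ultimately show "\<exists>Z. cyclic_flags H Z \<and> (\<forall>g\<in>Z. base H g \<noteq> x \<and> c g = i)" by blast
  qed
  ultimately show ?thesis unfolding three_cyclic_sides_def by blast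
qed

section \<open>Independence of the model\<close>

lemma isomorphicE:
  assumes "isomorphic G H"
  obtains \<alpha> \<beta> where "bij_betw \<alpha> (verts G) (verts H)" "bij_betw \<beta> (flags G) (flags H)"
    "\<And>h. h \<in> flags G \<Longrightarrow> base H (\<beta> h) = \<alpha> (base G h) \<and> opp H (\<beta> h) = \<beta> (opp G h) \<and>
       len H (\<beta> h) = len G h"
  using assms unfolding isomorphic_def
  by (elim exE conjE) (rule that, assumption, assumption, drule (1) bspec, assumption)

lemma isomorphic_sym:
  assumes "flag_graph G" "isomorphic G H"
  shows "isomorphic H G"
proof -
  obtain \<alpha> \<beta> where \<alpha>: "bij_betw \<alpha> (verts G) (verts H)" and \<beta>: "bij_betw \<beta> (flags G) (flags H)"
    and eq: "\<And>h. h \<in> flags G \<Longrightarrow> base H (\<beta> h) = \<alpha> (base G h) \<and> opp H (\<beta> h) = \<beta> (opp G h) \<and>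
       len H (\<beta> h) = len G h"
    by (rule isomorphicE[OF assms(2)]) (rule that, assumption, assumption, simp)
  let ?\<alpha> = "inv_into (verts G) \<alpha>" and ?\<beta> = "inv_into (flags G) \<beta>"
  have "base G (?\<beta> k) = ?\<alpha> (base H k) \<and> opp G (?\<beta> k) = ?\<beta> (opp H k) \<and> len G (?\<beta> k) = len H k"
    if k: "k \<in> flags H" for k
  proof -
    obtain h where h: "h \<in> flags G" "k = \<beta> h"
      using bij_betw_imp_surj_on[OF \<beta>] k by (metis imageE)
    then show ?thesis
      using eq[OF h(1)] flag_graphD[OF assms(1) h(1)] \<alpha> \<beta>
      by (simp add: bij_betw_def)
  qed
  then show ?thesis
    unfolding isomorphic_def using \<alpha> \<beta>
    by (intro exI[of _ ?\<alpha>] exI[of _ ?\<beta>]) (simp add: bij_betw_inv_into)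
qed

lemma flag_graph_isomorphic:
  assumes "flag_graph G" "isomorphic G H"
  shows "flag_graph H"
proof -
  obtain \<alpha> \<beta> where \<alpha>: "bij_betw \<alpha> (verts G) (verts H)" and \<beta>: "bij_betw \<beta> (flags G) (flags H)"
    and eq: "\<And>h. h \<in> flags G \<Longrightarrow> base H (\<beta> h) = \<alpha> (base G h) \<and> opp H (\<beta> h) = \<beta> (opp G h) \<and>
       len H (\<beta> h) = len G h"
    by (rule isomorphicE[OF assms(2)]) (rule that, assumption, assumption, simp)
  have "base H k \<in> verts H \<and> opp H k \<in> flags H \<and> opp H (opp H k) = k" if k: "k \<in> flags H" for k
  proof -
    obtain h where h: "h \<in> flags G" "k = \<beta> h"
      using bij_betw_imp_surj_on[OF \<beta>] k by (metis imageE)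
    then show ?thesis
      using eq[OF h(1)] eq[of "opp G h"] flag_graphD[OF assms(1) h(1)] \<alpha> \<beta>
      by (auto simp: bij_betw_def)
  qed
  then show ?thesis by (auto simp: flag_graph_def)
qed

lemma three_cyclic_sides_isomorphic:
  assumes fgG: "flag_graph G" and iso: "isomorphic G H" and "three_cyclic_sides G"
  shows "three_cyclic_sides H"
proof -
  have fg: "flag_graph H" using flag_graph_isomorphic[OF fgG iso] .
  \<comment> \<open>Colourings and flag sets are pulled back, hence along the inverse isomorphism.\<close>
  obtain \<alpha> \<beta> where \<alpha>: "bij_betw \<alpha> (verts H) (verts G)" and \<beta>: "bij_betw \<beta> (flags H) (flags G)"
    and eq: "\<And>h. h \<in> flags H \<Longrightarrow> base G (\<beta> h) = \<alpha> (base H h) \<and> opp G (\<beta> h) = \<beta> (opp H h) \<and>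
       len G (\<beta> h) = len H h"
    by (rule isomorphicE[OF isomorphic_sym[OF fgG iso]]) (rule that, assumption, assumption, simp)
  obtain x c where sep: "side_colouring G x c"
    and at: "\<And>i. i < 3 \<Longrightarrow> \<exists>h\<in>flags_at G x. c h = i"
    and cyc: "\<And>i. i < 3 \<Longrightarrow> \<exists>Z. cyclic_flags G Z \<and> (\<forall>h\<in>Z. base G h \<noteq> x \<and> c h = i)"
    using assms(3) unfolding three_cyclic_sides_def by blast
  have "x \<in> verts G" using at[of 0] flag_graphD(1)[OF fgG] by (auto simp: flags_at_def)
  then obtain y where y: "y \<in> verts H" "\<alpha> y = x" using bij_betw_imp_surj_on[OF \<alpha>] by (metis imageE)
  note fgD = flag_graphD[OF fg]
  have bx: "\<alpha> v = \<alpha> w \<longleftrightarrow> v = w" if "v \<in> verts H" "w \<in> verts H" for v w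
    using \<alpha> that by (auto simp: bij_betw_def inj_on_def)
  have ontoF: "\<exists>k\<in>flags H. \<beta> k = h" if "h \<in> flags G" for h
    using bij_betw_imp_surj_on[OF \<beta>] that by (metis imageE)
  have inF: "\<beta> k \<in> flags G" if "k \<in> flags H" for k
    using \<beta> that by (auto simp: bij_betw_def)
  have "side_colouring H y (c \<circ> \<beta>)"
    unfolding side_colouring_def
  proof (intro conjI ballI impI)
    fix k assume k: "k \<in> flags H"
    show "(c \<circ> \<beta>) (opp H k) = (c \<circ> \<beta>) k"
      using side_colouring_opp[OF sep inF[OF k]] eq[OF k] by simp
  next
    fix k l assume kl: "k \<in> flags H" "l \<in> flags H" "base H k = base H l" "base H k \<noteq> y"
    then have "base G (\<beta> k) \<noteq> x" using eq[OF kl(1)] bx[OF fgD(1)[OF kl(1)] y(1)] y(2) by simp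
    then show "(c \<circ> \<beta>) k = (c \<circ> \<beta>) l"
      using side_colouring_base[OF sep inF inF, of k l] eq kl by simp
  qed
  moreover have "\<exists>k\<in>flags_at H y. (c \<circ> \<beta>) k = i" if i: "i < 3" for i
  proof -
    obtain h where h: "h \<in> flags G" "base G h = x" "c h = i"
      using at[OF i] by (auto simp: flags_at_def)
    obtain k where k: "k \<in> flags H" "\<beta> k = h" using ontoF h by blast
    then have "base H k = y" using eq[OF k(1)] h y bx fgD(1)[OF k(1)] by metis
    then show ?thesis using k h by (auto simp: flags_at_def)
  qed
  moreover have "\<exists>Z. cyclic_flags H Z \<and> (\<forall>h\<in>Z. base H h \<noteq> y \<and> (c \<circ> \<beta>) h = i)" if i: "i < 3" for i
  proof -
    obtain Z where Z: "cyclic_flags G Z" "\<And>h. h \<in> Z \<Longrightarrow> base G h \<noteq> x \<and> c h = i"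
      using cyc[OF i] by blast
    define Y where "Y = {k \<in> flags H. \<beta> k \<in> Z}"
    have "cyclic_flags H Y"
      unfolding cyclic_flags_def
    proof (intro conjI ballI)
      show "Y \<noteq> {}" "Y \<subseteq> flags H" using Z(1) ontoF by (fastforce simp: cyclic_flags_def Y_def)+
      fix k assume "k \<in> Y"
      then have k: "k \<in> flags H" "\<beta> k \<in> Z" by (auto simp: Y_def)
      show "opp H k \<in> Y" "opp H k \<noteq> k"
        using Z(1) k eq[OF k(1)] fgD(2)[OF k(1)] by (auto simp: cyclic_flags_def Y_def)
      obtain h where h: "h \<in> Z" "h \<noteq> \<beta> k" "base G h = base G (\<beta> k)"
        using Z(1) k by (auto simp: cyclic_flags_def)
      then obtain l where l: "l \<in> flags H" "\<beta> l = h" using ontoF Z(1) by (auto simp: cyclic_flags_def)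
      then have "base H l = base H k" using h eq[OF l(1)] eq[OF k(1)] bx fgD k by metis
      then show "\<exists>h'\<in>Y. h' \<noteq> k \<and> base H h' = base H k" using h l by (auto simp: Y_def)
    qed
    moreover have "base H k \<noteq> y \<and> (c \<circ> \<beta>) k = i" if "k \<in> Y" for k
      using that Z(2)[of "\<beta> k"] eq[of k] y by (auto simp: Y_def)
    ultimately show ?thesis by blast
  qed
  ultimately show ?thesis unfolding three_cyclic_sides_def by blast
qed

lemma subdividesE [consumes 2, case_names vertex]:
  assumes "subdivides G K" "flag_graph G"
  obtains h v a b where
    "h \<in> flags G" "v \<notin> verts G" "a \<notin> flags G" "b \<notin> flags G" "a \<noteq> b"
    "verts K = insert v (verts G)" "flags K = {a, b} \<union> flags G"
    "base K a = v" "base K b = v" "\<And>g. g \<in> flags G \<Longrightarrow> base K g = base G g"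
    "opp K a = h" "opp K h = a" "opp K b = (if opp G h = h then b else opp G h)"
    "opp G h \<noteq> h \<Longrightarrow> opp K (opp G h) = b"
    "\<And>g. g \<in> flags G \<Longrightarrow> g \<noteq> h \<Longrightarrow> g \<noteq> opp G h \<Longrightarrow> opp K g = opp G g"
proof -
  obtain h v a b s where *: "h \<in> flags G" "v \<notin> verts G" "a \<notin> flags G" "b \<notin> flags G" "a \<noteq> b"
    and K: "let b' = (if opp G h = h then b else opp G h) in
      K = \<lparr>verts = insert v (verts G),
           flags = {a, b} \<union> flags G,
           base = (base G)(a := v, b := v),
           opp = (opp G)(b' := b, b := b', h := a, a := h),
           len = (len G)(b' := len G h - ereal s, b := len G h - ereal s,
                         h := ereal s, a := ereal s)\<rparr>"
    using assms(1) unfolding subdivides_def by (elim exE conjE) (rule that)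
  have "opp G h \<in> flags G" using assms(2) *(1) by (auto simp: flag_graph_def)
  then show thesis
    by (intro that[of h v a b]) (use * in \<open>auto simp: K[unfolded Let_def]\<close>)
qed

lemma flag_graph_subdivides:
  assumes "subdivides G K" "flag_graph G"
  shows "flag_graph K"
  using assms
proof (cases rule: subdividesE)
  case s: (vertex h v a b)
  note fgD = flag_graphD[OF assms(2)]
  have "base K g \<in> verts K \<and> opp K g \<in> flags K \<and> opp K (opp K g) = g" if g: "g \<in> flags K" for g
  proof -
    consider "g = a" | "g = b" | "g = h" | "g = opp G h" "opp G h \<noteq> h"
      | "g \<in> flags G" "g \<noteq> h" "g \<noteq> opp G h"
      using g s(7) by auto
    then show ?thesis
    proof cases
      case 5
      then have "opp G g \<noteq> h" "opp G g \<noteq> opp G h" using fgD(3)[OF s(1)] fgD(3)[of g] by auto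
      then show ?thesis using 5 s fgD by auto
    qed (use s fgD in auto)
  qed
  then show ?thesis by (auto simp: flag_graph_def)
qed

text \<open>
  The two new flags get the colour of the subdivided edge, and belong to the new cycle iff that edge
  belonged to the old one.
\<close>

lemma three_cyclic_sides_subdivides:
  assumes "subdivides G K" "flag_graph G" "three_cyclic_sides G"
  shows "three_cyclic_sides K"
  using assms(1,2)
proof (cases rule: subdividesE)
  case s: (vertex h v a b)
  note fgD = flag_graphD[OF assms(2)]
  obtain x c where sep: "side_colouring G x c"
    and at: "\<And>i. i < 3 \<Longrightarrow> \<exists>h\<in>flags_at G x. c h = i"
    and cyc: "\<And>i. i < 3 \<Longrightarrow> \<exists>Z. cyclic_flags G Z \<and> (\<forall>h\<in>Z. base G h \<noteq> x \<and> c h = i)"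
    using assms(3) unfolding three_cyclic_sides_def by blast
  have xv: "x \<noteq> v" using at[of 0] fgD(1) s(2) by (auto simp: flags_at_def)
  define d where "d = c(a := c h, b := c h)"
  have dG: "d g = c g" if "g \<in> flags G" for g using s(3,4) that by (auto simp: d_def)
  have dab: "d a = c h" "d b = c h" by (auto simp: d_def)
  note copp = side_colouring_opp[OF sep]
  have "side_colouring K x d"
    unfolding side_colouring_def
  proof (intro conjI ballI impI)
    fix g assume "g \<in> flags K"
    then consider "g = a" | "g = b" | "g = h" | "g = opp G h" "opp G h \<noteq> h"
      | "g \<in> flags G" "g \<noteq> h" "g \<noteq> opp G h"
      using s(7) by auto
    then show "d (opp K g) = d g"
      by cases (use s(1) s(11-15) dab dG copp fgD(2) in auto)
  next
    fix g g' assume g: "g \<in> flags K" "g' \<in> flags K" and eq: "base K g = base K g'" "base K g \<noteq> x"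
    have "base K k = v \<longleftrightarrow> k \<in> {a, b}" if "k \<in> flags K" for k
      using that s(2,7-10) fgD(1) by force
    then show "d g = d g'"
      using g eq s(7,10) dab dG sep unfolding side_colouring_def by (metis UnE insertE singletonD)
  qed
  moreover have "\<exists>g\<in>flags_at K x. d g = i" if "i < 3" for i
    using at[OF that] s(7,10) dG by (force simp: flags_at_def)
  moreover have "\<exists>Z. cyclic_flags K Z \<and> (\<forall>h\<in>Z. base K h \<noteq> x \<and> d h = i)" if i: "i < 3" for i
  proof -
    obtain Z where Z: "cyclic_flags G Z" "\<And>h. h \<in> Z \<Longrightarrow> base G h \<noteq> x \<and> c h = i"
      using cyc[OF i] by blast
    have ZG: "Z \<subseteq> flags G" and ne: "Z \<noteq> {}"
      and oZ: "\<And>g. g \<in> Z \<Longrightarrow> opp G g \<in> Z \<and> opp G g \<noteq> g"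
      and bZ: "\<And>g. g \<in> Z \<Longrightarrow> \<exists>h'\<in>Z. h' \<noteq> g \<and> base G h' = base G g"
      using Z(1) by (auto simp: cyclic_flags_def)
    define Y where "Y = Z \<union> (if h \<in> Z then {a, b} else {})"
    have hZ: "opp G h \<in> Z \<Longrightarrow> h \<in> Z" using oZ fgD(3)[OF s(1)] by metis
    have "cyclic_flags K Y"
      unfolding cyclic_flags_def
    proof (intro conjI ballI)
      show "Y \<noteq> {}" "Y \<subseteq> flags K" using ne ZG s(7) by (auto simp: Y_def)
      fix g assume g: "g \<in> Y"
      have oG: "opp G h \<in> flags G" using fgD s(1) by auto
      consider "g = a" "h \<in> Z" | "g = b" "h \<in> Z" | "g \<in> Z" "g = h"
        | "g \<in> Z" "g = opp G h" "opp G h \<noteq> h" "h \<in> Z" | "g \<in> Z" "g \<noteq> h" "g \<noteq> opp G h"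
        using g hZ by (auto simp: Y_def split: if_splits)
      then have "opp K g \<in> Y \<and> opp K g \<noteq> g"
      proof cases
        case 2
        then show ?thesis using s(4,13) oZ[of h] oG by (auto simp: Y_def)
      next
        case 5
        then show ?thesis using s(15)[of g] oZ[of g] ZG by (auto simp: Y_def)
      qed (use s(1,3,4,11-14) oG in \<open>auto simp: Y_def\<close>)
      then show "opp K g \<in> Y" "opp K g \<noteq> g" by auto
      show "\<exists>h'\<in>Y. h' \<noteq> g \<and> base K h' = base K g"
      proof (cases "g \<in> Z")
        case True
        then obtain h' where "h' \<in> Z" "h' \<noteq> g" "base G h' = base G g" using bZ by blast
        moreover have "g \<in> flags G" "h' \<in> flags G" using True \<open>h' \<in> Z\<close> ZG by auto
        ultimately show ?thesis using s(10) by (intro bexI[of _ h']) (auto simp: Y_def)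
      next
        case False
        then show ?thesis using g s(5,8,9) by (auto simp: Y_def split: if_splits)
      qed
    qed
    moreover have "base K g \<noteq> x \<and> d g = i" if "g \<in> Y" for g
      using that Z(2)[of g] Z(2)[of h] ZG s(8-10) dG dab xv by (auto simp: Y_def split: if_splits)
    ultimately show ?thesis by blast
  qed
  ultimately show ?thesis unfolding three_cyclic_sides_def by blast
qed

text \<open>
  The colouring and the cycles are simply restricted to the old flags.  At the added vertex \<open>v\<close> the flags
  \<open>a\<close> and \<open>b\<close> have the same colour and belong to the same cycles, so the two halves of the
  subdivided edge agree.
\<close>

lemma three_cyclic_sides_unsubdivide:
  assumes "subdivides G K" "flag_graph G" "three_cyclic_sides K"
  shows "three_cyclic_sides G"
  using assms(1,2)
proof (cases rule: subdividesE)
  case s: (vertex h v a b)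
  note fgD = flag_graphD[OF assms(2)]
  obtain x c where sep: "side_colouring K x c"
    and at: "\<And>i. i < 3 \<Longrightarrow> \<exists>h\<in>flags_at K x. c h = i"
    and cyc: "\<And>i. i < 3 \<Longrightarrow> \<exists>Z. cyclic_flags K Z \<and> (\<forall>h\<in>Z. base K h \<noteq> x \<and> c h = i)"
    using assms(3) unfolding three_cyclic_sides_def by blast
  have bv: "base K k = v \<longleftrightarrow> k \<in> {a, b}" if "k \<in> flags K" for k
    using that s(2,7-10) fgD(1) by force
  \<comment> \<open>The two flags at \<open>v\<close> do not suffice for three colours.\<close>
  have xv: "x \<noteq> v"
  proof
    assume "x = v"
    then have "flags_at K x \<subseteq> {a, b}" using bv by (auto simp: flags_at_def)
    then have "{..<3} \<subseteq> c ` {a, b}" using at by blast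
    then have "card {..<3::nat} \<le> card (c ` {a, b})" by (rule card_mono[rotated]) simp
    then show False by (simp add: card_insert_if split: if_splits)
  qed
  have cab: "c a = c b" using side_colouring_base[OF sep, of a b] s(7-9) xv by simp
  note copp = side_colouring_opp[OF sep]
  have ch: "c h = c a" "c (opp G h) = c a"
    using copp[of h] copp[of b] copp[of a] cab s(1,7,11,12,13) by (auto split: if_splits)
  have "side_colouring G x c"
    unfolding side_colouring_def
  proof (intro conjI ballI impI)
    fix g assume g: "g \<in> flags G"
    show "c (opp G g) = c g"
    proof (cases "g = h \<or> g = opp G h")
      case True
      then show ?thesis using ch fgD(3)[OF s(1)] by auto
    next
      case False
      then show ?thesis using s(15)[of g] copp[of g] g s(7) by auto
    qed
  next
    fix g g' assume "g \<in> flags G" "g' \<in> flags G" "base G g = base G g'" "base G g \<noteq> x"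
    then show "c g = c g'" using side_colouring_base[OF sep, of g g'] s(7,10) by simp
  qed
  moreover have "\<exists>g\<in>flags_at G x. c g = i" if "i < 3" for i
    using at[OF that] s(7-10) xv by (force simp: flags_at_def)
  moreover have "\<exists>Z. cyclic_flags G Z \<and> (\<forall>h\<in>Z. base G h \<noteq> x \<and> c h = i)" if i: "i < 3" for i
  proof -
    obtain Z where Z: "cyclic_flags K Z" "\<And>h. h \<in> Z \<Longrightarrow> base K h \<noteq> x \<and> c h = i"
      using cyc[OF i] by blast
    have ZK: "Z \<subseteq> flags K" and ne: "Z \<noteq> {}"
      and oZ: "\<And>g. g \<in> Z \<Longrightarrow> opp K g \<in> Z \<and> opp K g \<noteq> g"
      and bZ: "\<And>g. g \<in> Z \<Longrightarrow> \<exists>h'\<in>Z. h' \<noteq> g \<and> base K h' = base K g"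
      using Z(1) by (auto simp: cyclic_flags_def)
    \<comment> \<open>\<open>Z\<close> contains either all or none of the four flags of the subdivided edge; if that edge is unbounded,
      then none, since \<open>b\<close> is its own opposite.\<close>
    have ab: "a \<in> Z \<longleftrightarrow> b \<in> Z" using bZ bv ZK s(8,9) by (metis insertE singletonD subsetD)
    have ha: "h \<in> Z \<longleftrightarrow> a \<in> Z" using oZ s(11,12) by metis
    have hb: "opp G h \<in> Z \<and> opp G h \<noteq> h" if "b \<in> Z" using oZ[OF that] s(13) by (auto split: if_splits)
    have bh: "b \<in> Z" if "opp G h \<in> Z" using oZ[OF that] s(14) ha ab that by (cases "opp G h = h") auto
    have ZG: "g \<in> flags G" if "g \<in> Z - {a, b}" for g using that ZK s(7) by auto
    have "cyclic_flags G (Z - {a, b})"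
      unfolding cyclic_flags_def
    proof (intro conjI ballI)
      show "Z - {a, b} \<noteq> {}" using ne ab ha s(1,3,4) by auto
      show "Z - {a, b} \<subseteq> flags G" using ZK s(7) by auto
      fix g assume g: "g \<in> Z - {a, b}"
      then have gG: "g \<in> flags G" using ZK s(7) by auto
      have "opp G g \<in> Z \<and> opp G g \<noteq> g"
      proof (cases "g = h \<or> g = opp G h")
        case True
        then show ?thesis using g ab ha hb bh fgD(3)[OF s(1)] by auto
      next
        case False
        then show ?thesis using s(15)[OF gG] oZ[of g] g by auto
      qed
      then show "opp G g \<in> Z - {a, b}" "opp G g \<noteq> g" using fgD(2)[OF gG] s(3,4) by auto
      obtain h' where h': "h' \<in> Z" "h' \<noteq> g" "base K h' = base K g" using bZ g by blast
      have "h' \<notin> {a, b}" using h' bv[of h'] bv[of g] g ZK by auto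
      then show "\<exists>h'\<in>Z - {a, b}. h' \<noteq> g \<and> base G h' = base G g"
        using h' s(10)[OF gG] s(10)[OF ZG, of h'] by (intro bexI[of _ h']) auto
    qed
    moreover have "base G g \<noteq> x \<and> c g = i" if "g \<in> Z - {a, b}" for g
      using that Z(2)[of g] s(10)[OF ZG[OF that]] by simp
    ultimately show ?thesis by blast
  qed
  ultimately show ?thesis unfolding three_cyclic_sides_def by blast
qed

lemma three_cyclic_sides_refines:
  assumes "refines K G" "flag_graph G"
  shows "three_cyclic_sides K \<longleftrightarrow> three_cyclic_sides G"
proof -
  obtain A where iso: "isomorphic G A" and sub: "subdivides\<^sup>*\<^sup>* A K"
    using assms(1) unfolding refines_def by blast
  have fgA: "flag_graph A" using flag_graph_isomorphic[OF assms(2) iso] .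
  have "three_cyclic_sides A \<longleftrightarrow> three_cyclic_sides G"
    using three_cyclic_sides_isomorphic[OF assms(2) iso]
      three_cyclic_sides_isomorphic[OF fgA isomorphic_sym[OF assms(2) iso]] by blast
  moreover from sub have "flag_graph K \<and> (three_cyclic_sides K \<longleftrightarrow> three_cyclic_sides A)"
  proof (induction rule: rtranclp_induct)
    case base
    then show ?case using fgA by simp
  next
    case (step Y K)
    then show ?case
      using flag_graph_subdivides three_cyclic_sides_subdivides three_cyclic_sides_unsubdivide
      by blast
  qed
  ultimately show ?thesis by blast
qed

lemma three_cyclic_sides_same_metric_graph:
  assumes "same_metric_graph G H"
  shows "three_cyclic_sides G \<longleftrightarrow> three_cyclic_sides H"
proof -
  obtain K :: "(nat, nat) model" where K: "refines K G" "refines K H"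
    and "metric_graph G" "metric_graph H"
    using assms unfolding same_metric_graph_def by blast
  then show ?thesis
    using three_cyclic_sides_refines metric_graph_imp_flag_graph by metis
qed

section \<open>Independence of glued trees\<close>

text \<open>
  Adding an edge, with set of flags \<open>R\<close>, that is attached to the old graph at the vertex \<open>u\<close> only: it joins
  the side containing \<open>u\<close>, whose colour can be read off at any old flag at \<open>u\<close>.
\<close>

lemma three_cyclic_sides_glue:
  assumes "three_cyclic_sides H"
    and fl: "flags H = flags G - R" and same: "base H = base G" "opp H = opp G"
    and R: "\<And>h. h \<in> R \<Longrightarrow> opp G h \<in> R"
    and H: "\<And>h. h \<in> flags H \<Longrightarrow> opp G h \<in> flags H"
    and u: "\<And>h h'. h \<in> R \<Longrightarrow> h' \<in> flags H \<Longrightarrow> base G h' = base G h \<Longrightarrow> base G h = u"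
  shows "three_cyclic_sides G"
proof -
  obtain x c where sep: "side_colouring H x c"
    and at: "\<And>i. i < 3 \<Longrightarrow> \<exists>h\<in>flags_at H x. c h = i"
    and cyc: "\<And>i. i < 3 \<Longrightarrow> \<exists>Z. cyclic_flags H Z \<and> (\<forall>h\<in>Z. base H h \<noteq> x \<and> c h = i)"
    using assms(1) unfolding three_cyclic_sides_def by blast
  \<comment> \<open>If \<open>u = x\<close>, or if \<open>u\<close> has no old flag, then any constant colour on \<open>R\<close> will do.\<close>
  define g0 where "g0 = (SOME g. g \<in> flags_at H u)"
  define d where "d g = (if g \<in> R then c g0 else c g)" for g
  have g0: "g0 \<in> flags H \<and> base G g0 = u" if "g \<in> flags H" "base G g = u" for g
    using that someI[of "\<lambda>g. g \<in> flags_at H u" g] same by (auto simp: g0_def flags_at_def)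
  have dH: "d g = c g" if "g \<in> flags H" for g using that fl by (auto simp: d_def)
  have mixed: "d g = d g'"
    if "g \<in> R" "g' \<in> flags H" "base G g = base G g'" "base G g \<noteq> x" for g g'
  proof -
    have "base G g' = u" using u[OF that(1,2)] that(3) by auto
    moreover have "g0 \<in> flags H \<and> base G g0 = u" using g0 that(2) calculation by blast
    ultimately have "c g' = c g0"
      using side_colouring_base[OF sep, of g' g0] that same by simp
    then show ?thesis using dH that by (auto simp: d_def)
  qed
  have "side_colouring G x d"
    unfolding side_colouring_def
  proof (intro conjI ballI impI)
    fix g assume "g \<in> flags G"
    then show "d (opp G g) = d g"
      using R[of g] H[of g] side_colouring_opp[OF sep, of g] dH fl same
      by (cases "g \<in> R") (auto simp: d_def)
  next
    fix g g' assume g: "g \<in> flags G" "g' \<in> flags G" "base G g = base G g'" "base G g \<noteq> x"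
    consider "g \<in> R" "g' \<in> R" | "g \<in> R" "g' \<in> flags H" | "g \<in> flags H" "g' \<in> R"
      | "g \<in> flags H" "g' \<in> flags H"
      using g fl by blast
    then show "d g = d g'"
    proof cases
      case 1 then show ?thesis by (simp add: d_def)
    next
      case 2 then show ?thesis using mixed g by blast
    next
      case 3 then show ?thesis using mixed[of g' g] g by auto
    next
      case 4 then show ?thesis using side_colouring_base[OF sep, of g g'] dH g same by simp
    qed
  qed
  moreover have "\<exists>g\<in>flags_at G x. d g = i" if "i < 3" for i
    using at[OF that] fl same dH by (force simp: flags_at_def)
  moreover have "\<exists>Z. cyclic_flags G Z \<and> (\<forall>h\<in>Z. base G h \<noteq> x \<and> d h = i)" if i: "i < 3" for i
  proof -
    obtain Z where Z: "cyclic_flags H Z" "\<And>h. h \<in> Z \<Longrightarrow> base H h \<noteq> x \<and> c h = i"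
      using cyc[OF i] by blast
    then show ?thesis
      using same fl dH by (intro exI[of _ Z]) (auto simp: cyclic_flags_def subset_iff)
  qed
  ultimately show ?thesis unfolding three_cyclic_sides_def by blast
qed

lemma shrinks_step:
  assumes "shrinks G H" "flag_graph G"
  shows "flag_graph H" "three_cyclic_sides H \<Longrightarrow> three_cyclic_sides G"
proof -
  note fgD = flag_graphD[OF assms(2)]
  have "flag_graph H \<and> (three_cyclic_sides H \<longrightarrow> three_cyclic_sides G)"
  proof (cases "shrinks_end G H")
    case True
    then obtain h where h: "h \<in> flags G" "opp G h = h" and H: "H = G\<lparr>flags := flags G - {h}\<rparr>"
      unfolding shrinks_end_def by blast
    have opp: "opp G g \<noteq> h" if "g \<in> flags G" "g \<noteq> h" for g using fgD(3)[OF that(1)] h that by metis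
    have "flag_graph H" using fgD opp by (auto simp: flag_graph_def H)
    moreover have "three_cyclic_sides G" if "three_cyclic_sides H"
      by (rule three_cyclic_sides_glue[OF that, where R = "{h}" and u = "base G h"])
        (use h fgD opp in \<open>auto simp: H\<close>)
    ultimately show ?thesis by blast
  next
    case False
    then obtain v h where h: "flags_at G v = {h}" "opp G h \<noteq> h"
      and H: "H = G\<lparr>verts := verts G - {v}, flags := flags G - {h, opp G h}\<rparr>"
      using assms(1) unfolding shrinks_def shrinks_leaf_def by blast
    have hG: "h \<in> flags G" and v: "\<And>g. g \<in> flags G \<Longrightarrow> base G g = v \<longleftrightarrow> g = h"
      using h(1) by (auto simp: flags_at_def)
    have opp: "opp G g \<noteq> h \<and> opp G g \<noteq> opp G h" if "g \<in> flags G" "g \<noteq> h" "g \<noteq> opp G h" for g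
      using fgD(3)[OF that(1)] fgD(3)[OF hG] that by metis
    have "flag_graph H" using fgD opp v by (auto simp: flag_graph_def H)
    moreover have "three_cyclic_sides G" if "three_cyclic_sides H"
      by (rule three_cyclic_sides_glue[OF that, where R = "{h, opp G h}" and u = "base G (opp G h)"])
        (use hG v fgD opp in \<open>auto simp: H\<close>)
    ultimately show ?thesis by blast
  qed
  then show "flag_graph H" "three_cyclic_sides H \<Longrightarrow> three_cyclic_sides G" by auto
qed

lemma three_cyclic_sides_unshrink:
  assumes "shrinks\<^sup>*\<^sup>* G H" "flag_graph G" "three_cyclic_sides H"
  shows "three_cyclic_sides G"
  using assms
  by (induction rule: converse_rtranclp_induct) (auto dest: shrinks_step)

section \<open>Degrees of the sides of a cover\<close>

text \<open>
  As vertices have valence at most two, a cyclic set of flags contains all flags at each of its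
  vertices, hence by connectedness all flags.  Then every vertex has valence exactly two and every
  edge is bounded, so there are as many edges as vertices, and the Betti number is \<open>1\<close>.
\<close>

lemma path_has_no_cyclic_flags:
  assumes path: "is_path P" and Z: "cyclic_flags P Z"
  shows False
proof -
  have model: "is_model P" and conn: "connected_model P" and betti: "betti P = 0"
    and val: "\<And>v. v \<in> verts P \<Longrightarrow> valence P v \<le> 2"
    using path by (auto simp: is_path_def metric_graph_def)
  have fg: "flag_graph P" by (rule is_model_imp_flag_graph) fact
  note fgD = flag_graphD[OF fg]
  have fin: "finite (flags P)" "finite (verts P)" using model by (auto simp: is_model_def)
  have ZP: "Z \<subseteq> flags P" and ne: "Z \<noteq> {}"
    and oZ: "\<And>g. g \<in> Z \<Longrightarrow> opp P g \<in> Z \<and> opp P g \<noteq> g"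
    and bZ: "\<And>g. g \<in> Z \<Longrightarrow> \<exists>h'\<in>Z. h' \<noteq> g \<and> base P h' = base P g"
    using Z by (auto simp: cyclic_flags_def)
  have full: "flags_at P (base P g) \<subseteq> Z \<and> card (flags_at P (base P g)) = 2" if g: "g \<in> Z" for g
  proof -
    obtain g' where g': "g' \<in> Z" "g' \<noteq> g" "base P g' = base P g" using bZ g by blast
    have "{g, g'} \<subseteq> flags_at P (base P g)" using g g' ZP by (auto simp: flags_at_def)
    moreover have "card (flags_at P (base P g)) \<le> card {g, g'}"
      using val[of "base P g"] fgD(1) g g' ZP by (auto simp: valence_def)
    moreover have "finite (flags_at P (base P g))" using fin by (auto simp: flags_at_def)
    ultimately have "{g, g'} = flags_at P (base P g)" by (meson card_seteq)
    then show ?thesis using g g' by (metis card_2_iff empty_subsetI insert_subset)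
  qed
  obtain z where z: "z \<in> Z" using ne by blast
  have reach: "v \<in> base P ` Z" if "(base P z, v) \<in> (adjacency P)\<^sup>*" for v
    using that
  proof (induction rule: rtrancl_induct)
    case base
    then show ?case using z by blast
  next
    case (step u w)
    then obtain h g where h: "h \<in> flags P" "u = base P h" "w = base P (opp P h)"
      and g: "g \<in> Z" "u = base P g"
      by (auto simp: adjacency_def)
    then have "h \<in> Z" using full[OF g(1)] by (auto simp: flags_at_def)
    then show ?case using oZ h by blast
  qed
  have all: "v \<in> base P ` Z" if "v \<in> verts P" for v
    using reach conn that z ZP fgD(1) unfolding connected_model_def by blast
  have ZF: "Z = flags P"
    using ZP all full fgD(1) by (fastforce simp: flags_at_def)
  have "card (flags P) = (\<Sum>v\<in>verts P. card (flags_at P v))"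
    using card_UN_disjoint[of "verts P" "flags_at P"] fin fgD(1)
    by (subst card_UN_disjoint[symmetric]) (auto simp: flags_at_def intro!: arg_cong[where f = card])
  also have "\<dots> = (\<Sum>v\<in>verts P. 2)"
    using all full by (intro sum.cong) auto
  finally have "card (flags P) = 2 * card (verts P)" by simp
  moreover have "{h \<in> flags P. opp P h \<noteq> h} = flags P" using oZ ZF by auto
  ultimately show False using card_bounded_flags[OF model] betti by (simp add: betti_def)
qed

definition side_degree ::
  "('v, 'h) model \<Rightarrow> ('v, 'h, 'w, 'k) graph_map \<Rightarrow> ('h \<Rightarrow> nat) \<Rightarrow> nat \<Rightarrow> 'k \<Rightarrow> nat" where
  "side_degree G f c i k = (\<Sum>h\<in>{h \<in> flags G. c h = i \<and> on_flags f h = Some k}. mult f h)"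

lemma graph_morphismD:
  assumes "graph_morphism G P f" "h \<in> flags G" "on_flags f h = Some k"
  shows "k \<in> flags P" "base P k = on_verts f (base G h)" "on_flags f (opp G h) = Some (opp P k)"
    "mult f h > 0" "len P k = ereal (real (mult f h)) * len G h"
proof -
  have "case on_flags f h of
       None \<Rightarrow> mult f h = 0 \<and> on_flags f (opp G h) = None \<and>
               on_verts f (base G (opp G h)) = on_verts f (base G h)
     | Some h' \<Rightarrow> h' \<in> flags P \<and> base P h' = on_verts f (base G h) \<and>
               on_flags f (opp G h) = Some (opp P h') \<and>
               mult f h > 0 \<and> len P h' = ereal (real (mult f h)) * len G h"
    using assms(1,2) unfolding graph_morphism_def by blast
  then show "k \<in> flags P" "base P k = on_verts f (base G h)"
    "on_flags f (opp G h) = Some (opp P k)"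
    "mult f h > 0" "len P k = ereal (real (mult f h)) * len G h"
    using assms(3) by simp_all
qed

text \<open>
  On a bounded edge the multiplicity is the quotient of the lengths, which are the same for both flags;
  an unbounded edge has one flag only.
\<close>

lemma mult_opp:
  assumes mor: "graph_morphism G P f" and h: "h \<in> flags G" "on_flags f h = Some k"
  shows "mult f (opp G h) = mult f h"
proof (cases "opp G h = h")
  case False
  have G: "is_model G" and P: "is_model P" using mor by (auto simp: graph_morphism_def)
  have fin: "len G h \<noteq> \<infinity>" "0 < len G h" "len G (opp G h) = len G h" "opp G h \<in> flags G"
    using G h False by (auto simp: is_model_def)
  have "ereal (real (mult f (opp G h))) * len G h = len P (opp P k)"
    using graph_morphismD(5)[OF mor fin(4)] graph_morphismD(3)[OF mor h] fin by auto
  also have "\<dots> = ereal (real (mult f h)) * len G h"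
    using P graph_morphismD(1,5)[OF mor h] by (auto simp: is_model_def)
  finally show ?thesis using fin by (cases "len G h") auto
qed simp

lemma side_degree_opp:
  assumes mor: "graph_morphism G P f" and sep: "side_colouring G x c" and k: "k \<in> flags P"
  shows "side_degree G f c i (opp P k) = side_degree G f c i k"
proof -
  have G: "flag_graph G" and P: "flag_graph P"
    using mor by (auto simp: graph_morphism_def is_model_imp_flag_graph)
  note GD = flag_graphD[OF G] and PD = flag_graphD[OF P]
  note c = side_colouring_opp[OF sep]
  show ?thesis
    unfolding side_degree_def
  proof (rule sum.reindex_bij_witness[where i = "opp G" and j = "opp G"])
    fix h assume "h \<in> {h \<in> flags G. c h = i \<and> on_flags f h = Some (opp P k)}"
    then show "opp G h \<in> {h \<in> flags G. c h = i \<and> on_flags f h = Some k}"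
      "mult f (opp G h) = mult f h" "opp G (opp G h) = h"
      using GD PD(3)[OF k] c graph_morphismD(3)[OF mor] mult_opp[OF mor] by auto
  next
    fix h assume "h \<in> {h \<in> flags G. c h = i \<and> on_flags f h = Some k}"
    then show "opp G h \<in> {h \<in> flags G. c h = i \<and> on_flags f h = Some (opp P k)}"
      "opp G (opp G h) = h"
      using GD c graph_morphismD(3)[OF mor] by auto
  qed
qed

text \<open>
  Above a point other than \<open>f x\<close>, all flags at a vertex have the same colour, so a side consists of entire
  vertices there.  The vertex set does not depend on the edge \<open>k\<close> but only on its
  base, which is what lets harmonicity compare the two edges at a point.
\<close>

lemma side_degree_eq_sum_local_degree:
  assumes mor: "graph_morphism G P f" and sep: "side_colouring G x c" 
    and k: "base P k \<noteq> on_verts f x"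
  shows "side_degree G f c i k =
    (\<Sum>v\<in>{v \<in> verts G. on_verts f v = base P k \<and> (\<exists>h\<in>flags_at G v. c h = i)}. local_degree G f v k)"
proof -
  let ?V = "{v \<in> verts G. on_verts f v = base P k \<and> (\<exists>h\<in>flags_at G v. c h = i)}"
  have G: "flag_graph G" and fin: "finite (verts G)" "finite (flags G)"
    using mor by (auto simp: graph_morphism_def is_model_imp_flag_graph is_model_def)
  have "{h \<in> flags G. c h = i \<and> on_flags f h = Some k} =
      (\<Union>v\<in>?V. {h \<in> flags_at G v. on_flags f h = Some k})"
    (is "?A = ?B")
  proof (intro equalityI subsetI)
    fix h assume h: "h \<in> ?A"
    then have "on_verts f (base G h) = base P k" using graph_morphismD(2)[OF mor, of h k] by auto
    then show "h \<in> ?B" using h flag_graphD(1)[OF G] by (auto simp: flags_at_def)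
  next
    fix h assume "h \<in> ?B"
    then obtain g where g: "h \<in> flags G" "on_flags f h = Some k" "on_verts f (base G h) = base P k"
      "g \<in> flags G" "base G g = base G h" "c g = i"
      by (auto simp: flags_at_def)
    then have "base G g \<noteq> x" using k by auto
    then show "h \<in> ?A" using side_colouring_base[OF sep g(4,1,5)] g by simp
  qed
  then have "side_degree G f c i k = sum (mult f) (\<Union>v\<in>?V. {h \<in> flags_at G v. on_flags f h = Some k})"
    by (simp add: side_degree_def)
  also have "\<dots> = (\<Sum>v\<in>?V. local_degree G f v k)"
    unfolding local_degree_def using fin
    by (intro sum.UNION_disjoint) (auto simp: flags_at_def)
  finally show ?thesis .
qed

text \<open>
  Used above \<open>f x\<close>, where flags at \<open>x\<close> may contribute further to the side degree, so that equality fails.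
\<close>

lemma sum_local_degree_le_side_degree:
  assumes mor: "graph_morphism G P f" and sep: "side_colouring G x c"
    and V: "finite V" "\<And>v. v \<in> V \<Longrightarrow> v \<noteq> x \<and> (\<exists>h\<in>flags_at G v. c h = i)"
  shows "(\<Sum>v\<in>V. local_degree G f v k) \<le> side_degree G f c i k"
proof -
  have fin: "finite (flags G)" using mor by (auto simp: graph_morphism_def is_model_def)
  have "(\<Sum>v\<in>V. local_degree G f v k) = sum (mult f) (\<Union>v\<in>V. {h \<in> flags_at G v. on_flags f h = Some k})"
    unfolding local_degree_def using fin V(1)
    by (intro sum.UNION_disjoint[symmetric]) (auto simp: flags_at_def)
  also have "\<dots> \<le> side_degree G f c i k"
    unfolding side_degree_def
  proof (rule sum_mono2)
    show "(\<Union>v\<in>V. {h \<in> flags_at G v. on_flags f h = Some k}) \<subseteq>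
        {h \<in> flags G. c h = i \<and> on_flags f h = Some k}"
    proof
      fix h assume "h \<in> (\<Union>v\<in>V. {h \<in> flags_at G v. on_flags f h = Some k})"
      then have h: "h \<in> flags G" "on_flags f h = Some k" "base G h \<in> V"
        by (auto simp: flags_at_def)
      obtain g where "g \<in> flags G" "base G g = base G h" "c g = i"
        using V(2)[OF h(3)] by (auto simp: flags_at_def)
      moreover have "base G h \<noteq> x" using V(2)[OF h(3)] by blast
      ultimately have "c h = i" using side_colouring_base[OF sep] h(1) by metis
      then show "h \<in> {h \<in> flags G. c h = i \<and> on_flags f h = Some k}" using h by blast
    qed
  qed (use fin in auto)
  finally show ?thesis .
qed

text \<open>
  If an edge of the cycle is contracted, it is not a loop, so its two ends are different vertices
  above the same point, and each has local degree at least \<open>1\<close> by non-degeneracy.  Otherwise the cycle maps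
  to edges of the path.  Were this map injective on flags, its image would again be cyclic, which is
  impossible in a path; so two flags of the cycle have the same image.
\<close>

lemma cyclic_flags_have_double_point:
  assumes cover: "well_contracted_cover G P f d" and sep: "side_colouring G x c"
    and Z: "cyclic_flags G Z" and Zi: "\<And>h. h \<in> Z \<Longrightarrow> base G h \<noteq> x \<and> c h = i"
  shows "\<exists>k\<in>flags P. side_degree G f c i k \<ge> 2"
proof -
  have harm: "harmonic G P f" and nd: "non_degenerate G f" and path: "is_path P"
    using cover by (auto simp: well_contracted_cover_def tropical_cover_def)
  have mor: "graph_morphism G P f" using harm by (simp add: harmonic_def)
  have G: "flag_graph G" and fin: "finite (flags G)"
    using mor by (auto simp: graph_morphism_def is_model_imp_flag_graph is_model_def)
  note GD = flag_graphD[OF G]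
  have ZG: "Z \<subseteq> flags G" and ne: "Z \<noteq> {}"
    and oZ: "\<And>g. g \<in> Z \<Longrightarrow> opp G g \<in> Z \<and> opp G g \<noteq> g"
    and bZ: "\<And>g. g \<in> Z \<Longrightarrow> \<exists>h'\<in>Z. h' \<noteq> g \<and> base G h' = base G g"
    using Z by (auto simp: cyclic_flags_def)
  show ?thesis
  proof (cases "\<exists>h\<in>Z. on_flags f h = None")
    case True
    then obtain h where h: "h \<in> Z" "on_flags f h = None" by blast
    then have hG: "h \<in> flags G" "opp G h \<in> flags G" using ZG GD(2) by auto
    define u v where "u = base G h" and "v = base G (opp G h)"
    have uv: "u \<noteq> v" using nd h hG oZ by (auto simp: non_degenerate_def u_def v_def)
    have fuv: "on_verts f v = on_verts f u"
      using mor hG(1) h(2) by (auto simp: graph_morphism_def u_def v_def split: option.splits)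
    have pos: "\<exists>k\<in>flags_at P (on_verts f y). local_degree G f y k \<ge> 1" if y: "y \<in> verts G" for y
    proof -
      obtain g where g: "g \<in> flags G" "base G g = y" "mult f g > 0"
        using nd y unfolding non_degenerate_def flags_at_def by blast
      obtain k where k: "on_flags f g = Some k"
        using mor g by (cases "on_flags f g") (auto simp: graph_morphism_def)
      have "mult f g \<le> local_degree G f y k"
        unfolding local_degree_def using g k fin by (intro member_le_sum) (auto simp: flags_at_def)
      then show ?thesis
        using g(2,3) graph_morphismD(1,2)[OF mor g(1) k] by (force simp: flags_at_def)
    qed
    have V: "u \<in> verts G" "v \<in> verts G" using GD(1) hG by (auto simp: u_def v_def)
    obtain k where k: "k \<in> flags_at P (on_verts f u)" "local_degree G f u k \<ge> 1"
      using pos[OF V(1)] by blast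
    \<comment> \<open>The flag at the common image above which \<open>v\<close> has positive degree may differ from \<open>k\<close>; harmonicity
      corrects this.\<close>
    have "local_degree G f v k \<ge> 1"
      using pos[OF V(2)] k harm V fuv unfolding harmonic_def by metis
    then have "2 \<le> (\<Sum>y\<in>{u, v}. local_degree G f y k)" using k uv by simp
    also have "\<dots> \<le> side_degree G f c i k"
    proof (rule sum_local_degree_le_side_degree[OF mor sep])
      show "y \<noteq> x \<and> (\<exists>h\<in>flags_at G y. c h = i)" if "y \<in> {u, v}" for y
        using that h oZ[of h] Zi hG by (fastforce simp: flags_at_def u_def v_def)
    qed simp
    finally show ?thesis using k(1) by (auto simp: flags_at_def)
  next
    case False
    define F where "F h = the (on_flags f h)" for h
    have F: "on_flags f h = Some (F h)" if "h \<in> Z" for h using False that by (auto simp: F_def)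
    show ?thesis
    proof (rule ccontr)
      assume small: "\<not> ?thesis"
      have inj: "g = h" if gh: "g \<in> Z" "h \<in> Z" "F g = F h" for g h
      proof (rule ccontr)
        assume "g \<noteq> h"
        have pos: "mult f g > 0" "mult f h > 0" and k: "F h \<in> flags P"
          using graph_morphismD(1,4)[OF mor] F gh ZG by blast+
        have "2 \<le> sum (mult f) {g, h}" using pos \<open>g \<noteq> h\<close> by simp
        also have "\<dots> \<le> side_degree G f c i (F h)"
          unfolding side_degree_def using gh F ZG Zi fin by (intro sum_mono2) auto
        finally show False using small k by blast
      qed
      have "cyclic_flags P (F ` Z)"
        unfolding cyclic_flags_def
      proof (intro conjI ballI)
        show "F ` Z \<noteq> {}" "F ` Z \<subseteq> flags P" using ne F ZG graph_morphismD(1)[OF mor] by blast+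
        fix k assume "k \<in> F ` Z"
        then obtain h where h: "h \<in> Z" "k = F h" by blast
        have Fo: "F (opp G h) = opp P k"
          using graph_morphismD(3)[OF mor _ F[OF h(1)]] ZG h F[of "opp G h"] oZ by auto
        show "opp P k \<in> F ` Z" using Fo oZ[OF h(1)] by (metis imageI)
        show "opp P k \<noteq> k" using Fo inj[of "opp G h" h] oZ[OF h(1)] h by auto
        obtain h' where h': "h' \<in> Z" "h' \<noteq> h" "base G h' = base G h" using bZ h by blast
        have "F h' \<noteq> k" using inj h h' by blast
        moreover have "base P (F h') = base P k"
          using graph_morphismD(2)[OF mor _ F] ZG h h' by (metis subsetD)
        ultimately show "\<exists>k'\<in>F ` Z. k' \<noteq> k \<and> base P k' = base P k" using h' by blast
      qed
      then show False using path_has_no_cyclic_flags path by blast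
    qed
  qed
qed

text \<open>
  The set of flags of side degree at least \<open>m\<close> contains with each flag its opposite, and with each
  flag not based at \<open>f x\<close> all flags at the same point.  As the target is connected, such a set is empty or
  contains a flag at \<open>f x\<close>.
\<close>

lemma side_degree_reaches_image:
  assumes cover: "well_contracted_cover G P f d" and sep: "side_colouring G x c"
    and x: "x \<in> verts G" and k: "k \<in> flags P" "side_degree G f c i k \<ge> m"
  shows "\<exists>k'\<in>flags_at P (on_verts f x). side_degree G f c i k' \<ge> m"
proof (rule ccontr)
  assume no: "\<not> ?thesis"
  have harm: "harmonic G P f" and conn: "connected_model P" and P: "flag_graph P"
    using cover metric_graph_imp_flag_graph
    by (auto simp: well_contracted_cover_def tropical_cover_def is_path_def metric_graph_def
        is_model_imp_flag_graph)
  have mor: "graph_morphism G P f" using harm by (simp add: harmonic_def)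
  note PD = flag_graphD[OF P]
  define S where "S = {k \<in> flags P. side_degree G f c i k \<ge> m}"
  have opp: "opp P l \<in> S" if "l \<in> S" for l
    using that side_degree_opp[OF mor sep] PD(2) by (auto simp: S_def)
  have spread: "l' \<in> S" if l: "l \<in> S" "l' \<in> flags P" "base P l' = base P l" for l l'
  proof -
    have ne: "base P l \<noteq> on_verts f x" using no l(1) by (auto simp: S_def flags_at_def)
    have "local_degree G f v l = local_degree G f v l'"
      if "v \<in> verts G" "on_verts f v = base P l" for v
    proof -
      have "l \<in> flags_at P (on_verts f v)" "l' \<in> flags_at P (on_verts f v)"
        using that l by (auto simp: flags_at_def S_def)
      then show ?thesis using harm that(1) unfolding harmonic_def by blast
    qed
    then have "side_degree G f c i l' = side_degree G f c i l"
      using side_degree_eq_sum_local_degree[OF mor sep, of l i] ne l(3)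
        side_degree_eq_sum_local_degree[OF mor sep, of l' i]
      by (auto intro!: sum.cong)
    then show ?thesis using l by (auto simp: S_def)
  qed
  have "v \<in> base P ` S" if "(base P k, v) \<in> (adjacency P)\<^sup>*" for v
    using that
  proof (induction rule: rtrancl_induct)
    case base
    then show ?case using k by (auto simp: S_def)
  next
    case (step u w)
    then obtain h g where h: "h \<in> flags P" "u = base P h" "w = base P (opp P h)"
      and g: "g \<in> S" "u = base P g"
      by (auto simp: adjacency_def)
    then show ?case using spread[OF g(1) h(1)] opp by auto
  qed
  moreover have "on_verts f x \<in> verts P" using mor x by (auto simp: graph_morphism_def)
  ultimately have "on_verts f x \<in> base P ` S"
    using conn PD(1)[OF k(1)] unfolding connected_model_def by blast
  then show False using no by (auto simp: S_def flags_at_def)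
qed

section \<open>Sprawling nodes obstruct covers of degree three\<close>

lemma three_cyclic_sides_no_cover:
  assumes "three_cyclic_sides G"
  shows "\<not> well_contracted_cover G P f 3"
proof
  assume cover: "well_contracted_cover G P f 3"
  have mor: "graph_morphism G P f" and deg: "has_degree G P f 3" and path: "is_path P"
    using cover by (auto simp: well_contracted_cover_def tropical_cover_def harmonic_def)
  have G: "flag_graph G" and fin: "finite (flags G)"
    using mor by (auto simp: graph_morphism_def is_model_imp_flag_graph is_model_def)
  obtain x c where sep: "side_colouring G x c"
    and at: "\<And>i. i < 3 \<Longrightarrow> \<exists>h\<in>flags_at G x. c h = i"
    and cyc: "\<And>i. i < 3 \<Longrightarrow> \<exists>Z. cyclic_flags G Z \<and> (\<forall>h\<in>Z. base G h \<noteq> x \<and> c h = i)"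
    using assms unfolding three_cyclic_sides_def by blast
  have x: "x \<in> verts G" using at[of 0] flag_graphD(1)[OF G] by (auto simp: flags_at_def)
  let ?T = "flags_at P (on_verts f x)"
  have "\<exists>k\<in>?T. side_degree G f c i k \<ge> 2" if "i < 3" for i
    using cyc[OF that] cyclic_flags_have_double_point[OF cover sep]
      side_degree_reaches_image[OF cover sep x] by meson
  then obtain K where K: "\<And>i. i < 3 \<Longrightarrow> K i \<in> ?T \<and> side_degree G f c i (K i) \<ge> 2" by metis
  have "on_verts f x \<in> verts P" and finP: "finite ?T"
    using mor x by (auto simp: graph_morphism_def is_model_def flags_at_def)
  then have "card ?T \<le> 2" using path by (auto simp: is_path_def valence_def)
  moreover have "K ` {..<3} \<subseteq> ?T" using K by auto
  ultimately have "card (K ` {..<3}) < card {..<3::nat}"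
    using card_mono[OF finP, of "K ` {..<3}"] by simp
  then have "\<not> inj_on K {..<3}" by (rule pigeonhole)
  then obtain i j where ij: "i < 3" "j < 3" "i \<noteq> j" "K i = K j"
    unfolding inj_on_def by blast
  have kP: "K i \<in> flags P" using K[OF ij(1)] by (auto simp: flags_at_def)
  let ?A = "\<lambda>i. {h \<in> flags G. c h = i \<and> on_flags f h = Some (K j)}"
  have "4 \<le> sum (mult f) (?A i) + sum (mult f) (?A j)"
    using K[OF ij(1)] K[OF ij(2)] ij(4) by (simp add: side_degree_def)
  also have "\<dots> = sum (mult f) (?A i \<union> ?A j)"
    using fin ij(3) by (intro sum.union_disjoint[symmetric]) auto
  also have "\<dots> \<le> sum (mult f) {h \<in> flags G. on_flags f h = Some (K j)}"
    using fin by (intro sum_mono2) auto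
  also have "\<dots> = 3" using deg kP ij(4) by (simp add: has_degree_def)
  finally show False by simp
qed

theorem lemma5p2:
  fixes \<Gamma> :: "('v, 'h) model" and w :: "'v \<Rightarrow> nat"
  assumes "metric_graph \<Gamma>"
    and "genus \<Gamma> w \<ge> 3"
    and "has_sprawling_node \<Gamma>"
  shows "\<forall>M :: ('w, 'k) model. tropical_modification M \<Gamma> \<longrightarrow> \<not> admits_well_contracted_cover M 3"
proof (intro allI impI notI)
  fix M :: "('w, 'k) model"
  assume M: "tropical_modification M \<Gamma>" and adm: "admits_well_contracted_cover M 3"
  obtain C and H :: "(nat, nat) model" and x h S
    where C: "canonical_model \<Gamma> C" and HC: "same_metric_graph H C" and H: "sprawling_at H x h S"
    using assms(3) unfolding has_sprawling_node_def by blast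
  have "three_cyclic_sides H"
    using sprawling_imp_three_cyclic_sides H HC
    by (auto simp: same_metric_graph_def metric_graph_def)
  then have "three_cyclic_sides C" using three_cyclic_sides_same_metric_graph[OF HC] by blast
  then have \<Gamma>: "three_cyclic_sides \<Gamma>"
    using three_cyclic_sides_unshrink C assms(1) metric_graph_imp_flag_graph
    unfolding canonical_model_def by blast
  obtain G' where G': "shrinks\<^sup>*\<^sup>* M G'" "same_metric_graph G' \<Gamma>" and "metric_graph M"
    using M unfolding tropical_modification_def by blast
  then have "three_cyclic_sides M"
    using three_cyclic_sides_unshrink three_cyclic_sides_same_metric_graph \<Gamma>
      metric_graph_imp_flag_graph by blast
  moreover obtain K P :: "(nat, nat) model" and f
    where "same_metric_graph K M" "well_contracted_cover K P f 3"
    using adm unfolding admits_well_contracted_cover_def by blast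
  ultimately show False
    using three_cyclic_sides_same_metric_graph three_cyclic_sides_no_cover by blast
qed

end
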